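(* Let $H_\mu$ be a subset of $L_\infty(D)$, with the embedding $f\mapsto f$ mapping $H_\mu$ into $L_\infty(D)$. Let $U(f)=\sum_{j=1}^n f(x_j)\,g_j$ with $x_j\in D$ and $g_j\in L_\infty(D)$, and put $$h^*(\cdot,x)=R_\mu(\cdot,x)-\sum_{j=1}^n g_j(x)\,R_\mu(\cdot,x_j)\in H_\mu,\qquad x\in D.$$ Then the average case error of $U$ for multivariate function approximation in $L_2(D)$ and the worst case error of $U$ for approximation in $L_\infty(D)$ over the unit ball of $H_\mu$ are $$e^{\rm avg}(U)=\Bigl(\int_D\|h^*(\cdot,x)\|_\mu^2\,dx\Bigr)^{1/2},\qquad e^{\rm wor}(U)=\operatorname*{ess\,sup}_{x\in D}\|h^*(\cdot,x)\|_\mu,$$ and consequently $$e^{\rm avg}(U)\le\sqrt{l(D)}\;e^{\rm wor}(U),$$ where $l(D)$ is the Lebesgue volume of $D$.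
   Context: $F$ is a separable Banach space of functions $f:D\to\mathbb R$, where $D\subset\mathbb R^d$ has Lebesgue volume $l(D)\in(0,+\infty)$, $F\subset L_2(D)$, and all evaluations $f\mapsto f(x)$, $x\in D$, belong to $F^*$. $\mu$ is a zero mean Gaussian measure on $F$ with covariance kernel $R_\mu(t,x)=\int_F f(t)f(x)\,\mu(df)$. $H_\mu$ is the reproducing kernel Hilbert space with kernel $R_\mu$, i.e. the completion of the spaces $\mathrm{span}(R_\mu(\cdot,x_1),\dots,R_\mu(\cdot,x_k))$ with respect to the norm $\|\cdot\|_\mu=\langle\cdot,\cdot\rangle_\mu^{1/2}$ determined by $\langle R_\mu(\cdot,x),R_\mu(\cdot,t)\rangle_\mu=R_\mu(x,t)$. The errors are $$e^{\rm avg}(U)=\Bigl(\int_F\|f-U(f)\|_{L_2(D)}^2\,\mu(df)\Bigr)^{1/2},\qquad e^{\rm wor}(U)=\sup\bigl\{\|f-U(f)\|_{L_\infty(D)}:\ f\in H_\mu,\ \|f\|_\mu\le1\bigr\}.$$ *)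

theory Defs
  imports "HOL-Probability.Probability"
begin

section \<open>The function classes $L_2(D)$ and $L_\infty(D)$\<close>

text \<open>Functions on \<open>D\<close> are total functions; only their values on \<open>D\<close> matter.
  Norms and errors take values in $[0,\infty]$.\<close>

definition ennsqrt :: "ennreal \<Rightarrow> ennreal" where
  "ennsqrt a = (if a = \<infinity> then \<infinity> else ennreal (sqrt (enn2real a)))"

definition L2_norm :: "(real ^ 'd) set \<Rightarrow> (real ^ 'd \<Rightarrow> real) \<Rightarrow> ennreal" where
  "L2_norm D f = ennsqrt (\<integral>\<^sup>+ x. ennreal ((f x)\<^sup>2) \<partial>lebesgue_on D)"

definition Linf_norm :: "(real ^ 'd) set \<Rightarrow> (real ^ 'd \<Rightarrow> real) \<Rightarrow> ennreal" where
  "Linf_norm D f = esssup (lebesgue_on D) (\<lambda>x. ennreal \<bar>f x\<bar>)"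

definition L2 :: "(real ^ 'd) set \<Rightarrow> (real ^ 'd \<Rightarrow> real) set" where
  "L2 D = {f. f \<in> borel_measurable (lebesgue_on D) \<and> L2_norm D f < \<infinity>}"

definition Linf :: "(real ^ 'd) set \<Rightarrow> (real ^ 'd \<Rightarrow> real) set" where
  "Linf D = {f. f \<in> borel_measurable (lebesgue_on D) \<and> Linf_norm D f < \<infinity>}"

section \<open>Banach spaces of functions and Gaussian measures\<close>

text \<open>A Banach space \<open>F\<close> of functions on \<open>D\<close> is a Banach space type \<open>'f\<close> with an evaluation map
  \<open>val\<close>, where \<open>val f x\<close> is the value of \<open>f\<close> at \<open>x\<close>. Linearity of the evaluations says that the
  vector space operations of \<open>F\<close> are the pointwise ones, injectivity that an element of \<open>F\<close> is
  determined by its values on \<open>D\<close>.\<close>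

definition separable_function_space ::
    "(real ^ 'd) set \<Rightarrow> ('f::banach \<Rightarrow> real ^ 'd \<Rightarrow> real) \<Rightarrow> bool" where
  "separable_function_space D val \<longleftrightarrow>
     separable_space (euclidean :: 'f topology) \<and>
     (\<forall>x\<in>D. bounded_linear (\<lambda>f. val f x)) \<and>
     inj (\<lambda>f. restrict (val f) D) \<and>
     (\<forall>f. val f \<in> L2 D)"

definition gaussian_on_line :: "real measure \<Rightarrow> bool" where
  "gaussian_on_line \<nu> \<longleftrightarrow>
     (\<exists>m. \<nu> = return borel m) \<or>
     (\<exists>m \<sigma>. \<sigma> > 0 \<and> \<nu> = density lborel (\<lambda>x. ennreal (normal_density m \<sigma> x)))"

definition zero_mean_gaussian :: "'f::banach measure \<Rightarrow> bool" where
  "zero_mean_gaussian \<mu> \<longleftrightarrow>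
     prob_space \<mu> \<and> sets \<mu> = sets borel \<and>
     (\<forall>\<Lambda>. bounded_linear \<Lambda> \<longrightarrow>
        gaussian_on_line (distr \<mu> borel \<Lambda>) \<and> integral\<^sup>L \<mu> \<Lambda> = 0)"

definition cov_kernel :: "('f \<Rightarrow> 'a \<Rightarrow> real) \<Rightarrow> 'f measure \<Rightarrow> 'a \<Rightarrow> 'a \<Rightarrow> real" where
  "cov_kernel val \<mu> t x = (\<integral>f. val f t * val f x \<partial>\<mu>)"

section \<open>The reproducing kernel Hilbert space\<close>

text \<open>An element $\sum_x c_x K(\cdot,x)$ of the span of the kernel sections is represented by its
  finitely supported coefficient family \<open>c\<close>.\<close>

definition kcoeffs :: "'a set \<Rightarrow> ('a \<Rightarrow> real) set" where
  "kcoeffs D = {c. finite {x. c x \<noteq> 0} \<and> {x. c x \<noteq> 0} \<subseteq> D}"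

definition kcomb :: "('a \<Rightarrow> 'a \<Rightarrow> real) \<Rightarrow> ('a \<Rightarrow> real) \<Rightarrow> 'a \<Rightarrow> real" where
  "kcomb K c t = (\<Sum>x | c x \<noteq> 0. c x * K t x)"

definition kinner :: "('a \<Rightarrow> 'a \<Rightarrow> real) \<Rightarrow> ('a \<Rightarrow> real) \<Rightarrow> ('a \<Rightarrow> real) \<Rightarrow> real" where
  "kinner K c d = (\<Sum>x | c x \<noteq> 0. \<Sum>t | d t \<noteq> 0. c x * d t * K x t)"

definition knorm :: "('a \<Rightarrow> 'a \<Rightarrow> real) \<Rightarrow> ('a \<Rightarrow> real) \<Rightarrow> real" where
  "knorm K c = sqrt (kinner K c c)"

text \<open>The completion of the span is realised as a space of functions: it consists of the pointwise
  limits on \<open>D\<close> of norm-Cauchy sequences in the span, normed by the limit of the norms (which does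
  not depend on the sequence if \<open>K\<close> is symmetric and positive semidefinite).\<close>

definition kcauchy_to ::
    "'a set \<Rightarrow> ('a \<Rightarrow> 'a \<Rightarrow> real) \<Rightarrow> (nat \<Rightarrow> 'a \<Rightarrow> real) \<Rightarrow> ('a \<Rightarrow> real) \<Rightarrow> bool" where
  "kcauchy_to D K C f \<longleftrightarrow>
     (\<forall>k. C k \<in> kcoeffs D) \<and>
     (\<forall>e>0. \<exists>N. \<forall>k\<ge>N. \<forall>l\<ge>N. knorm K (\<lambda>x. C k x - C l x) < e) \<and>
     (\<forall>t\<in>D. (\<lambda>k. kcomb K (C k) t) \<longlonglongrightarrow> f t)"

definition rkhs :: "'a set \<Rightarrow> ('a \<Rightarrow> 'a \<Rightarrow> real) \<Rightarrow> ('a \<Rightarrow> real) set" where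
  "rkhs D K = {f. \<exists>C. kcauchy_to D K C f}"

definition rkhs_norm :: "'a set \<Rightarrow> ('a \<Rightarrow> 'a \<Rightarrow> real) \<Rightarrow> ('a \<Rightarrow> real) \<Rightarrow> real" where
  "rkhs_norm D K f = (THE r. \<exists>C. kcauchy_to D K C f \<and> (\<lambda>k. knorm K (C k)) \<longlonglongrightarrow> r)"

section \<open>Algorithms and their errors\<close>

definition sample_alg ::
    "nat \<Rightarrow> (nat \<Rightarrow> 'a) \<Rightarrow> (nat \<Rightarrow> 'a \<Rightarrow> real) \<Rightarrow> ('a \<Rightarrow> real) \<Rightarrow> 'a \<Rightarrow> real" where
  "sample_alg n x g f = (\<lambda>t. \<Sum>j=1..n. f (x j) * g j t)"

definition hstar ::
    "('a \<Rightarrow> 'a \<Rightarrow> real) \<Rightarrow> nat \<Rightarrow> (nat \<Rightarrow> 'a) \<Rightarrow> (nat \<Rightarrow> 'a \<Rightarrow> real) \<Rightarrow> 'a \<Rightarrow> 'a \<Rightarrow> real" where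
  "hstar K n x g y = (\<lambda>t. K t y - (\<Sum>j=1..n. g j y * K t (x j)))"

definition avg_error ::
    "(real ^ 'd) set \<Rightarrow> ('f \<Rightarrow> real ^ 'd \<Rightarrow> real) \<Rightarrow> 'f measure \<Rightarrow>
     ((real ^ 'd \<Rightarrow> real) \<Rightarrow> real ^ 'd \<Rightarrow> real) \<Rightarrow> ennreal" where
  "avg_error D val \<mu> U =
     ennsqrt (\<integral>\<^sup>+ f. (L2_norm D (\<lambda>t. val f t - U (val f) t))\<^sup>2 \<partial>\<mu>)"

definition wor_error ::
    "(real ^ 'd) set \<Rightarrow> (real ^ 'd \<Rightarrow> real ^ 'd \<Rightarrow> real) \<Rightarrow>
     ((real ^ 'd \<Rightarrow> real) \<Rightarrow> real ^ 'd \<Rightarrow> real) \<Rightarrow> ennreal" where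
  "wor_error D K U =
     (SUP f\<in>{f \<in> rkhs D K. rkhs_norm D K f \<le> 1}. Linf_norm D (\<lambda>t. f t - U f t))"

end

theory Submission
  imports Defs
begin

text \<open>The span of the kernel sections embeds isometrically into \<open>L\<^sub>2(\<mu>)\<close> by
  \<open>R(\<cdot>,t) \<mapsto> (f \<mapsto> f t)\<close>, and \<open>h\<^sup>*(\<cdot>,y)\<close> corresponds to the error functional
  \<open>f \<mapsto> f y - U f y\<close>. So Tonelli gives the average case error. By the reproducing property
  \<open>f y - U f y = \<langle>f, h\<^sup>*(\<cdot>,y)\<rangle>\<close> on the Hilbert space, and Cauchy-Schwarz bounds the worst case error
  by the essential supremum. For the converse it suffices to test with the normalised functions
  \<open>h\<^sup>*(\<cdot>,z)\<close>, \<open>z\<close> in a countable set, since the error functionals are weak* separable and, for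
  Gaussian measures, pointwise convergence of functionals implies convergence in \<open>L\<^sub>2(\<mu>)\<close>.\<close>

section \<open>Positive semidefinite kernels\<close>

lemma kcoeffs_zero: "(\<lambda>_. 0) \<in> kcoeffs D"
  by (simp add: kcoeffs_def)

lemma kcoeffs_add:
  assumes "c \<in> kcoeffs D" "d \<in> kcoeffs D"
  shows "(\<lambda>t. c t + d t) \<in> kcoeffs D"
proof -
  have "{t. c t + d t \<noteq> 0} \<subseteq> {t. c t \<noteq> 0} \<union> {t. d t \<noteq> 0}"
    by auto
  then show ?thesis
    using assms unfolding kcoeffs_def by (auto dest: finite_subset)
qed

lemma kcoeffs_scale:
  assumes "c \<in> kcoeffs D"
  shows "(\<lambda>t. r * c t) \<in> kcoeffs D"
proof -
  have "{t. r * c t \<noteq> 0} \<subseteq> {t. c t \<noteq> 0}"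
    by auto
  then show ?thesis
    using assms unfolding kcoeffs_def by (auto dest: finite_subset)
qed

lemma kcoeffs_diff:
  assumes "c \<in> kcoeffs D" "d \<in> kcoeffs D"
  shows "(\<lambda>t. c t - d t) \<in> kcoeffs D"
  using kcoeffs_add[OF assms(1) kcoeffs_scale[OF assms(2), of "-1"]] by simp

lemma kcoeffs_sum:
  assumes "\<And>j. j \<in> J \<Longrightarrow> c j \<in> kcoeffs D"
  shows "(\<lambda>t. \<Sum>j\<in>J. c j t) \<in> kcoeffs D"
  using assms
  by (induction J rule: infinite_finite_induct) (auto intro: kcoeffs_zero kcoeffs_add)

lemma kcoeffs_indicator: "y \<in> D \<Longrightarrow> indicator {y} \<in> kcoeffs D"
  by (simp add: kcoeffs_def indicator_def)

text \<open>Supports change under linear operations; over a common finite superset linearity holds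
  term by term.\<close>

lemma kcomb_superset:
  assumes "finite A" "{x. c x \<noteq> 0} \<subseteq> A"
  shows "kcomb K c t = (\<Sum>x\<in>A. c x * K t x)"
  unfolding kcomb_def using assms by (intro sum.mono_neutral_left) auto

lemma kcomb_add:
  assumes "c \<in> kcoeffs D" "d \<in> kcoeffs D"
  shows "kcomb K (\<lambda>x. c x + d x) t = kcomb K c t + kcomb K d t"
proof -
  let ?A = "{x. c x \<noteq> 0} \<union> {x. d x \<noteq> 0}"
  have A: "finite ?A"
    using assms by (simp add: kcoeffs_def)
  have sub: "{x. c x \<noteq> 0} \<subseteq> ?A" "{x. d x \<noteq> 0} \<subseteq> ?A" "{x. c x + d x \<noteq> 0} \<subseteq> ?A"
    by auto
  show ?thesis
    unfolding sub[THEN kcomb_superset[OF A]] by (simp add: sum.distrib distrib_right)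
qed

lemma kcomb_scale:
  assumes "c \<in> kcoeffs D"
  shows "kcomb K (\<lambda>x. r * c x) t = r * kcomb K c t"
proof -
  let ?A = "{x. c x \<noteq> 0}"
  have A: "finite ?A"
    using assms by (simp add: kcoeffs_def)
  show ?thesis
    using kcomb_superset[OF A, of c] kcomb_superset[OF A, of "\<lambda>x. r * c x"]
    by (auto simp: sum_distrib_left algebra_simps)
qed

lemma kcomb_diff:
  assumes "c \<in> kcoeffs D" "d \<in> kcoeffs D"
  shows "kcomb K (\<lambda>x. c x - d x) t = kcomb K c t - kcomb K d t"
  using kcomb_add[OF assms(1) kcoeffs_scale[OF assms(2), of "-1"]] kcomb_scale[OF assms(2), of K "-1"]
  by simp

lemma kcomb_sum:
  assumes "\<And>j. j \<in> J \<Longrightarrow> c j \<in> kcoeffs D"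
  shows "kcomb K (\<lambda>x. \<Sum>j\<in>J. c j x) t = (\<Sum>j\<in>J. kcomb K (c j) t)"
  using assms
proof (induction J rule: infinite_finite_induct)
  case (insert j J)
  then show ?case
    using kcomb_add[of "c j" D "\<lambda>x. \<Sum>j\<in>J. c j x"] by (simp add: kcoeffs_sum)
qed (simp_all add: kcomb_def)

lemma kcomb_indicator: "kcomb K (indicator {y}) t = K t y"
  by (simp add: kcomb_def indicator_def)

text \<open>Positivity is asked for families supported in \<open>D\<close>, where the evaluations
  are controlled. The form is semidefinite, so \<open>knorm\<close> may vanish on nonzero
  families.\<close>

locale psd_kernel =
  fixes D :: "'a set" and K :: "'a \<Rightarrow> 'a \<Rightarrow> real"
  assumes kernel_sym: "K s t = K t s"
    and kernel_psd: "c \<in> kcoeffs D \<Longrightarrow> 0 \<le> kinner K c c"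
begin

text \<open>The reproducing property \<open>\<langle>f, K(\<cdot>,t)\<rangle> = f t\<close>, extended linearly in the second argument.\<close>

lemma kinner_eq_kcomb: "kinner K c d = (\<Sum>t | d t \<noteq> 0. d t * kcomb K c t)"
proof -
  have "kinner K c d = (\<Sum>t | d t \<noteq> 0. \<Sum>x | c x \<noteq> 0. c x * d t * K x t)"
    unfolding kinner_def by (rule sum.swap)
  also have "\<dots> = (\<Sum>t | d t \<noteq> 0. d t * kcomb K c t)"
    unfolding kcomb_def sum_distrib_left
    by (intro sum.cong refl) (use kernel_sym in \<open>simp add: mult_ac\<close>)
  finally show ?thesis .
qed

section \<open>The semi-inner product and its seminorm\<close>

lemma kinner_sym: "kinner K c d = kinner K d c"
  unfolding kinner_def
  by (subst sum.swap, intro sum.cong refl) (use kernel_sym in \<open>simp add: mult_ac\<close>)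

lemma kinner_add_left:
  assumes "c \<in> kcoeffs D" "d \<in> kcoeffs D"
  shows "kinner K (\<lambda>x. c x + d x) e = kinner K c e + kinner K d e"
  by (simp add: kinner_eq_kcomb kcomb_add[OF assms] distrib_left sum.distrib)

lemma kinner_scale_left:
  assumes "c \<in> kcoeffs D"
  shows "kinner K (\<lambda>x. r * c x) e = r * kinner K c e"
  by (simp add: kinner_eq_kcomb kcomb_scale[OF assms] sum_distrib_left mult_ac)

lemma kinner_diff_left:
  assumes "c \<in> kcoeffs D" "d \<in> kcoeffs D"
  shows "kinner K (\<lambda>x. c x - d x) e = kinner K c e - kinner K d e"
  using kinner_add_left[OF assms(1) kcoeffs_scale[OF assms(2), of "-1"]]
    kinner_scale_left[OF assms(2), of "-1"]
  by simp

lemma knorm_square: "c \<in> kcoeffs D \<Longrightarrow> (knorm K c)\<^sup>2 = kinner K c c"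
  by (simp add: knorm_def kernel_psd)

lemma knorm_nonneg: "c \<in> kcoeffs D \<Longrightarrow> 0 \<le> knorm K c"
  by (simp add: knorm_def kernel_psd)

lemma knorm_scale: "c \<in> kcoeffs D \<Longrightarrow> knorm K (\<lambda>x. r * c x) = \<bar>r\<bar> * knorm K c"
  unfolding knorm_def
  by (subst kinner_scale_left, assumption, subst kinner_sym, subst kinner_scale_left, assumption)
    (simp add: real_sqrt_mult mult.assoc[symmetric])

lemma knorm_add_scale_square:
  assumes "c \<in> kcoeffs D" "d \<in> kcoeffs D"
  shows "(knorm K (\<lambda>x. c x + r * d x))\<^sup>2 = (knorm K c)\<^sup>2 + 2 * r * kinner K c d + r\<^sup>2 * (knorm K d)\<^sup>2"
proof -
  have rd: "(\<lambda>x. r * d x) \<in> kcoeffs D"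
    using assms by (rule_tac kcoeffs_scale)
  have 1: "kinner K e (\<lambda>x. c x + r * d x) = kinner K c e + r * kinner K d e" for e
    by (subst kinner_sym) (simp add: kinner_add_left[OF assms(1) rd] kinner_scale_left[OF assms(2)])
  show ?thesis
    using assms rd
    by (simp add: knorm_square kcoeffs_add 1 kinner_sym[of "\<lambda>x. c x + r * d x"] kinner_sym[of d c]
        power2_eq_square[of r] algebra_simps)
qed

lemma kinner_Cauchy_Schwarz:
  assumes c: "c \<in> kcoeffs D" and d: "d \<in> kcoeffs D"
  shows "\<bar>kinner K c d\<bar> \<le> knorm K c * knorm K d"
proof -
  have pos: "0 \<le> (knorm K c)\<^sup>2 + 2 * r * kinner K c d + r\<^sup>2 * (knorm K d)\<^sup>2" for r
    using knorm_add_scale_square[OF c d, of r] by (metis zero_le_power2)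
  show ?thesis
  proof (cases "knorm K d = 0")
    case True
    have "kinner K c d = 0"
    proof (rule ccontr)
      assume "kinner K c d \<noteq> 0"
      \<comment> \<open>Here the quadratic is affine in \<open>r\<close>; the chosen
        \<open>r\<close> makes it equal to -1.\<close>
      then show False
        using pos[of "- ((knorm K c)\<^sup>2 + 1) / (2 * kinner K c d)"] True by (simp add: field_simps)
    qed
    then show ?thesis
      using True by simp
  next
    case False
    \<comment> \<open>The chosen \<open>r\<close> minimises the quadratic.\<close>
    have "0 \<le> (knorm K c)\<^sup>2 - (kinner K c d)\<^sup>2 / (knorm K d)\<^sup>2"
      using pos[of "- kinner K c d / (knorm K d)\<^sup>2"] False
      by (simp add: field_simps power2_eq_square)
    then have "(kinner K c d)\<^sup>2 \<le> (knorm K c * knorm K d)\<^sup>2"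
      using False by (simp add: field_simps)
    then show ?thesis
      using knorm_nonneg[OF c] knorm_nonneg[OF d] by (simp add: abs_le_square_iff[symmetric])
  qed
qed

lemma knorm_triangle:
  assumes c: "c \<in> kcoeffs D" and d: "d \<in> kcoeffs D"
  shows "knorm K (\<lambda>x. c x + d x) \<le> knorm K c + knorm K d"
proof (rule power2_le_imp_le)
  show "(knorm K (\<lambda>x. c x + d x))\<^sup>2 \<le> (knorm K c + knorm K d)\<^sup>2"
    using knorm_add_scale_square[OF c d, of 1] kinner_Cauchy_Schwarz[OF c d]
    by (simp add: power2_sum)
  show "0 \<le> knorm K c + knorm K d"
    using knorm_nonneg[OF c] knorm_nonneg[OF d] by simp
qed

lemma knorm_minus_commute:
  assumes "c \<in> kcoeffs D" "d \<in> kcoeffs D"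
  shows "knorm K (\<lambda>x. c x - d x) = knorm K (\<lambda>x. d x - c x)"
  using knorm_scale[OF kcoeffs_diff[OF assms], of "-1"] by simp

lemma knorm_diff_ineq:
  assumes c: "c \<in> kcoeffs D" and d: "d \<in> kcoeffs D"
  shows "\<bar>knorm K c - knorm K d\<bar> \<le> knorm K (\<lambda>x. c x - d x)"
  using knorm_triangle[OF kcoeffs_diff[OF c d] d] knorm_triangle[OF kcoeffs_diff[OF d c] c]
    knorm_minus_commute[OF c d]
  by simp

section \<open>The completion of the span and its norm\<close>

lemma kinner_tendsto_0:
  assumes "\<And>t. t \<in> D \<Longrightarrow> (\<lambda>k. kcomb K (C k) t) \<longlonglongrightarrow> 0" "d \<in> kcoeffs D"
  shows "(\<lambda>k. kinner K (C k) d) \<longlonglongrightarrow> 0"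
  \<comment> \<open>Against a fixed \<open>d\<close> the form sees only values at the finitely many
    points of the support of \<open>d\<close>.\<close>
  unfolding kinner_eq_kcomb
  by (rule tendsto_null_sum, rule tendsto_mult_right_zero, rule assms)
    (use assms(2) in \<open>auto simp: kcoeffs_def\<close>)

text \<open>The completion of the span is a space of functions: expand
  \<open>\<parallel>C k\<parallel>\<^sup>2 = \<parallel>C k - C N\<parallel>\<^sup>2 + 2 \<langle>C k, C N\<rangle> - \<parallel>C N\<parallel>\<^sup>2\<close> and let \<open>k\<close> tend to infinity for
  a fixed large \<open>N\<close>.\<close>

lemma knorm_tendsto_0:
  assumes C: "kcauchy_to D K C (\<lambda>_. 0)"
  shows "(\<lambda>k. knorm K (C k)) \<longlonglongrightarrow> 0"
proof (rule LIMSEQ_I)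
  fix e :: real assume e: "0 < e"
  have Ck: "C k \<in> kcoeffs D" for k
    using C by (simp add: kcauchy_to_def)
  obtain N where N: "\<And>k l. N \<le> k \<Longrightarrow> N \<le> l \<Longrightarrow> knorm K (\<lambda>x. C k x - C l x) < e / 2"
    using C e unfolding kcauchy_to_def by (meson half_gt_zero)
  have "(\<lambda>k. kinner K (C k) (C N)) \<longlonglongrightarrow> 0"
    using C Ck by (intro kinner_tendsto_0) (auto simp: kcauchy_to_def)
  then obtain M where M: "\<And>k. M \<le> k \<Longrightarrow> \<bar>kinner K (C k) (C N)\<bar> < e\<^sup>2 / 4"
    using LIMSEQ_D[of _ 0 "e\<^sup>2 / 4"] e by fastforce
  show "\<exists>M. \<forall>k\<ge>M. norm (knorm K (C k) - 0) < e"
  proof (intro exI allI impI)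
    fix k assume k: "max M N \<le> k"
    have MN: "\<bar>kinner K (C k) (C N)\<bar> < e\<^sup>2 / 4"
      using M k by simp
    have "(knorm K (\<lambda>x. C k x - C N x))\<^sup>2 < (e / 2)\<^sup>2"
      using N[of k N] k knorm_nonneg[OF kcoeffs_diff[OF Ck Ck]] by (intro power_strict_mono) auto
    moreover have "(knorm K (\<lambda>x. C k x - C N x))\<^sup>2
        = (knorm K (C k))\<^sup>2 - 2 * kinner K (C k) (C N) + (knorm K (C N))\<^sup>2"
      using knorm_add_scale_square[OF Ck Ck, of k "-1" N] by simp
    moreover have e4: "(e / 2)\<^sup>2 = e\<^sup>2 / 4"
      by (simp add: power_divide)
    \<comment> \<open>The square of the norm of \<open>C N\<close> enters with a minus sign and is
      dropped; the rest stays below 3/4 of the square of \<open>e\<close>.\<close>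
    ultimately have "(knorm K (C k))\<^sup>2 < e\<^sup>2 / 4 + 2 * (e\<^sup>2 / 4)"
      using MN[unfolded abs_less_iff] zero_le_power2[of "knorm K (C N)"] e4 by linarith
    also have "\<dots> < e\<^sup>2"
      using e by simp
    finally show "norm (knorm K (C k) - 0) < e"
      using e knorm_nonneg[OF Ck] by (simp add: power_less_imp_less_base)
  qed
qed

lemma kcauchy_to_diff:
  assumes C: "kcauchy_to D K C f" and B: "kcauchy_to D K B h"
  shows "kcauchy_to D K (\<lambda>k x. C k x - B k x) (\<lambda>t. f t - h t)"
proof -
  have Ck: "C k \<in> kcoeffs D" and Bk: "B k \<in> kcoeffs D" for k
    using C B by (simp_all add: kcauchy_to_def)
  have "\<exists>N. \<forall>k\<ge>N. \<forall>l\<ge>N. knorm K (\<lambda>x. (C k x - B k x) - (C l x - B l x)) < e" if e: "0 < e" for e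
  proof -
    obtain N where N: "\<And>k l. N \<le> k \<Longrightarrow> N \<le> l \<Longrightarrow> knorm K (\<lambda>x. C k x - C l x) < e / 2"
      using C e unfolding kcauchy_to_def by (meson half_gt_zero)
    obtain M where M: "\<And>k l. M \<le> k \<Longrightarrow> M \<le> l \<Longrightarrow> knorm K (\<lambda>x. B k x - B l x) < e / 2"
      using B e unfolding kcauchy_to_def by (meson half_gt_zero)
    show ?thesis
    proof (intro exI allI impI)
      fix k l assume kl: "max M N \<le> k" "max M N \<le> l"
      have "knorm K (\<lambda>x. (C k x - B k x) - (C l x - B l x))
          = knorm K (\<lambda>x. (C k x - C l x) + (B l x - B k x))"
        by (simp add: algebra_simps)
      also have "\<dots> \<le> knorm K (\<lambda>x. C k x - C l x) + knorm K (\<lambda>x. B l x - B k x)"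
        by (intro knorm_triangle kcoeffs_diff Ck Bk)
      also have "\<dots> < e"
        using N[of k l] M[of l k] kl by simp
      finally show "knorm K (\<lambda>x. (C k x - B k x) - (C l x - B l x)) < e" .
    qed
  qed
  moreover have "(\<lambda>k. kcomb K (\<lambda>x. C k x - B k x) t) \<longlonglongrightarrow> f t - h t" if "t \<in> D" for t
    using C B that by (auto simp: kcomb_diff[OF Ck Bk] kcauchy_to_def intro: tendsto_diff)
  ultimately show ?thesis
    using kcoeffs_diff[OF Ck Bk] by (simp add: kcauchy_to_def)
qed

text \<open>This makes the definite description in \<open>rkhs_norm\<close> meaningful: the norms
  are Cauchy by the reverse triangle inequality, and the difference of two representing sequences
  tends to 0 pointwise on \<open>D\<close>, hence in norm.\<close>

lemma knorm_tendsto_rkhs_norm: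
  assumes C: "kcauchy_to D K C f"
  shows "(\<lambda>k. knorm K (C k)) \<longlonglongrightarrow> rkhs_norm D K f"
proof -
  have Ck: "C k \<in> kcoeffs D" for k
    using C by (simp add: kcauchy_to_def)
  have "Cauchy (\<lambda>k. knorm K (C k))"
  proof (rule metric_CauchyI)
    fix e :: real assume "0 < e"
    then obtain N where N: "\<And>k l. N \<le> k \<Longrightarrow> N \<le> l \<Longrightarrow> knorm K (\<lambda>x. C k x - C l x) < e"
      using C unfolding kcauchy_to_def by meson
    have "dist (knorm K (C k)) (knorm K (C l)) < e" if "N \<le> k" "N \<le> l" for k l
      unfolding dist_real_def using knorm_diff_ineq[OF Ck Ck] N[OF that] by (rule le_less_trans)
    then show "\<exists>N. \<forall>k\<ge>N. \<forall>l\<ge>N. dist (knorm K (C k)) (knorm K (C l)) < e"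
      by blast
  qed
  then obtain r where r: "(\<lambda>k. knorm K (C k)) \<longlonglongrightarrow> r"
    by (auto simp: Cauchy_convergent_iff convergent_def)
  have "s = r" if B: "kcauchy_to D K B f" and s: "(\<lambda>k. knorm K (B k)) \<longlonglongrightarrow> s" for B s
  proof -
    have Bk: "B k \<in> kcoeffs D" for k
      using B by (simp add: kcauchy_to_def)
    have "(\<lambda>k. knorm K (\<lambda>x. B k x - C k x)) \<longlonglongrightarrow> 0"
      using kcauchy_to_diff[OF B C] by (intro knorm_tendsto_0) simp
    then have "(\<lambda>k. knorm K (B k) - knorm K (C k)) \<longlonglongrightarrow> 0"
      by (rule Lim_null_comparison[rotated]) (use knorm_diff_ineq[OF Bk Ck] in simp)
    then have "s - r = 0"
      using tendsto_diff[OF s r] by (rule LIMSEQ_unique[rotated])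
    then show ?thesis
      by simp
  qed
  then have "rkhs_norm D K f = r"
    unfolding rkhs_norm_def using C r by (intro the_equality) blast+
  then show ?thesis
    using r by simp
qed

lemma kcauchy_to_kcomb: "c \<in> kcoeffs D \<Longrightarrow> kcauchy_to D K (\<lambda>_. c) (kcomb K c)"
  by (simp add: kcauchy_to_def knorm_def kinner_def)

lemma kcomb_in_rkhs: "c \<in> kcoeffs D \<Longrightarrow> kcomb K c \<in> rkhs D K"
  using kcauchy_to_kcomb by (auto simp: rkhs_def)

lemma rkhs_norm_kcomb: "c \<in> kcoeffs D \<Longrightarrow> rkhs_norm D K (kcomb K c) = knorm K c"
  using knorm_tendsto_rkhs_norm[OF kcauchy_to_kcomb] by (simp add: LIMSEQ_const_iff)

end

text \<open>The coefficients of \<open>hstar\<close>. As a sum of point masses, it adds up the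
  weights of coinciding nodes, or of a node equal to \<open>y\<close>.\<close>

definition hcoeff :: "nat \<Rightarrow> (nat \<Rightarrow> 'a) \<Rightarrow> (nat \<Rightarrow> 'a \<Rightarrow> real) \<Rightarrow> 'a \<Rightarrow> 'a \<Rightarrow> real" where
  "hcoeff n x g y = (\<lambda>t. indicator {y} t - (\<Sum>j=1..n. g j y * indicator {x j} t))"

lemma hcoeff_in_kcoeffs:
  assumes "y \<in> D" "\<And>j. j \<in> {1..n} \<Longrightarrow> x j \<in> D"
  shows "hcoeff n x g y \<in> kcoeffs D"
  unfolding hcoeff_def using assms
  by (intro kcoeffs_diff kcoeffs_sum kcoeffs_scale kcoeffs_indicator) auto

text \<open>The kernel is arbitrary, so that the identity can also be applied to
  \<open>\<lambda>_. val f\<close>.\<close>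

lemma kcomb_hcoeff: "kcomb K (hcoeff n x g y) = hstar K n x g y"
proof
  fix t
  have ind: "indicator {z} \<in> kcoeffs UNIV" for z :: 'a
    by (rule kcoeffs_indicator) simp
  show "kcomb K (hcoeff n x g y) t = hstar K n x g y t"
    unfolding hcoeff_def hstar_def
    by (simp only: kcomb_diff[OF ind kcoeffs_sum[OF kcoeffs_scale[OF ind]]]
        kcomb_sum[OF kcoeffs_scale[OF ind]] kcomb_scale[OF ind] kcomb_indicator)
qed

context psd_kernel
begin

text \<open>By the reproducing property at \<open>y\<close> and at the nodes, \<open>hstar\<close>
  represents the error functional at \<open>y\<close>.\<close>

lemma kinner_hcoeff:
  assumes "y \<in> D" "\<And>j. j \<in> {1..n} \<Longrightarrow> x j \<in> D" "c \<in> kcoeffs D"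
  shows "kinner K c (hcoeff n x g y) = kcomb K c y - sample_alg n x g (kcomb K c) y"
proof -
  have ind: "indicator {z} \<in> kcoeffs UNIV" for z :: 'a
    by (rule kcoeffs_indicator) simp
  have point: "kinner K (indicator {z}) c = kcomb K c z" for z
    by (subst kinner_sym, subst kinner_eq_kcomb) (simp add: indicator_def)
  have "kinner K (hcoeff n x g y) c = (\<Sum>t | c t \<noteq> 0. c t * hstar K n x g y t)"
    by (simp add: kinner_eq_kcomb kcomb_hcoeff)
  also have "\<dots> = kinner K (indicator {y}) c - (\<Sum>j=1..n. g j y * kinner K (indicator {x j}) c)"
  proof -
    have "c t * hstar K n x g y t = c t * K t y - (\<Sum>j=1..n. g j y * (c t * K t (x j)))" for t
      by (simp add: hstar_def right_diff_distrib sum_distrib_left mult.left_commute)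
    then have "(\<Sum>t | c t \<noteq> 0. c t * hstar K n x g y t)
        = (\<Sum>t | c t \<noteq> 0. c t * K t y) - (\<Sum>t | c t \<noteq> 0. \<Sum>j=1..n. g j y * (c t * K t (x j)))"
      by (simp add: sum_subtractf)
    also have "(\<Sum>t | c t \<noteq> 0. \<Sum>j=1..n. g j y * (c t * K t (x j)))
        = (\<Sum>j=1..n. g j y * (\<Sum>t | c t \<noteq> 0. c t * K t (x j)))"
      by (subst sum.swap) (simp add: sum_distrib_left)
    finally show ?thesis
      by (simp only: kinner_eq_kcomb kcomb_indicator)
  qed
  finally show ?thesis
    by (simp add: kinner_sym[of c] point sample_alg_def mult.commute)
qed

text \<open>On the span this is Cauchy-Schwarz. Both sides pass to the limit along a representing
  sequence: the left one involves only values at \<open>y\<close> and at the nodes, the right one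
  only the norms.\<close>

lemma rkhs_error_le:
  assumes y: "y \<in> D" and x: "\<And>j. j \<in> {1..n} \<Longrightarrow> x j \<in> D" and f: "f \<in> rkhs D K"
  shows "\<bar>f y - sample_alg n x g f y\<bar> \<le> rkhs_norm D K f * knorm K (hcoeff n x g y)"
proof -
  obtain C where C: "kcauchy_to D K C f"
    using f by (auto simp: rkhs_def)
  have Ck: "C k \<in> kcoeffs D" for k
    using C by (simp add: kcauchy_to_def)
  have lim: "(\<lambda>k. kcomb K (C k) t) \<longlonglongrightarrow> f t" if "t \<in> D" for t
    using C that by (simp add: kcauchy_to_def)
  have "(\<lambda>k. \<bar>kcomb K (C k) y - sample_alg n x g (kcomb K (C k)) y\<bar>)
      \<longlonglongrightarrow> \<bar>f y - sample_alg n x g f y\<bar>"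
    unfolding sample_alg_def using lim y x by (intro tendsto_intros) auto
  moreover have "\<bar>kcomb K (C k) y - sample_alg n x g (kcomb K (C k)) y\<bar>
      \<le> knorm K (C k) * knorm K (hcoeff n x g y)" for k
    using kinner_Cauchy_Schwarz[OF Ck hcoeff_in_kcoeffs, of y n x k g] kinner_hcoeff[of y n x "C k" g]
      y x Ck by simp
  moreover have "(\<lambda>k. knorm K (C k) * knorm K (hcoeff n x g y))
      \<longlonglongrightarrow> rkhs_norm D K f * knorm K (hcoeff n x g y)"
    by (rule tendsto_mult_right[OF knorm_tendsto_rkhs_norm[OF C]])
  ultimately show ?thesis
    by (intro LIMSEQ_le) auto
qed

end

section \<open>Zero mean Gaussian measures\<close>

text \<open>Under \<open>\<mu>\<close> the functional is a centred normal variable or almost surely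
  0, and the cosine integral is the real part of its characteristic function at 1.\<close>

lemma zero_mean_gaussian_functional:
  fixes \<mu> :: "'f::banach measure" and L :: "'f \<Rightarrow> real"
  assumes \<mu>: "zero_mean_gaussian \<mu>" and L: "bounded_linear L"
  shows "integrable \<mu> (\<lambda>f. (L f)\<^sup>2)"
    and "(\<integral>f. cos (L f) \<partial>\<mu>) = exp (- (\<integral>f. (L f)\<^sup>2 \<partial>\<mu>) / 2)"
proof -
  interpret prob_space \<mu>
    using \<mu> by (simp add: zero_mean_gaussian_def)
  have [measurable]: "L \<in> borel_measurable \<mu>"
    using \<mu> L borel_measurable_continuous_onI[OF linear_continuous_on[OF L]]
    by (simp add: zero_mean_gaussian_def cong: measurable_cong_sets)
  have mean: "(\<integral>f. L f \<partial>\<mu>) = 0" and G: "gaussian_on_line (distr \<mu> borel L)"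
    using \<mu> L by (auto simp: zero_mean_gaussian_def)
  from G have "integrable \<mu> (\<lambda>f. (L f)\<^sup>2) \<and>
      (\<integral>f. cos (L f) \<partial>\<mu>) = exp (- (\<integral>f. (L f)\<^sup>2 \<partial>\<mu>) / 2)"
    unfolding gaussian_on_line_def
  proof (elim disjE exE conjE)
    fix m assume dirac: "distr \<mu> borel L = return borel m"
    have "(\<integral>f. L f \<partial>\<mu>) = (\<integral>s. s \<partial>distr \<mu> borel L)"
      by (subst integral_distr) auto
    \<comment> \<open>Mean zero puts the point mass at 0.\<close>
    then have "m = 0"
      using mean by (simp add: dirac integral_return)
    then have "AE s in distr \<mu> borel L. s = 0"
      unfolding dirac by (subst AE_return) auto
    then have ae: "AE f in \<mu>. L f = 0"
      by (subst (asm) AE_distr_iff) auto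
    have "integrable \<mu> (\<lambda>f. (L f)\<^sup>2) \<longleftrightarrow> integrable \<mu> (\<lambda>_. 0 :: real)"
      by (rule integrable_cong_AE) (use ae in auto)
    moreover have "(\<integral>f. (L f)\<^sup>2 \<partial>\<mu>) = (\<integral>f. 0 \<partial>\<mu>)"
      by (rule integral_cong_AE) (use ae in auto)
    moreover have "(\<integral>f. cos (L f) \<partial>\<mu>) = (\<integral>f. 1 \<partial>\<mu>)"
      by (rule integral_cong_AE) (use ae in auto)
    ultimately show ?thesis
      by (simp add: prob_space)
  next
    fix m \<sigma> :: real
    assume \<sigma>: "\<sigma> > 0" and dens: "distr \<mu> borel L = density lborel (\<lambda>x. ennreal (normal_density m \<sigma> x))"
    have "distributed \<mu> lborel L (normal_density m \<sigma>)"
      using dens distr_cong[OF refl sets_lborel refl, of \<mu> L] by (simp add: distributed_def)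
    moreover from this have "m = 0"
      using normal_distributed_expectation[OF \<sigma>] mean by simp
    ultimately have D: "distributed \<mu> lborel L (normal_density 0 \<sigma>)"
      by simp
    have int: "integrable \<mu> (\<lambda>f. (L f)\<^sup>2)"
      using distributed_integrable[OF D, of "\<lambda>s. s\<^sup>2"] integrable_normal_moment[OF \<sigma>, of 0 2]
      by simp
    have var: "(\<integral>f. (L f)\<^sup>2 \<partial>\<mu>) = \<sigma>\<^sup>2"
      using normal_distributed_variance[OF \<sigma> D] mean by simp
    have "distributed \<mu> lborel (\<lambda>f. L f / \<sigma>) std_normal_density"
      using D normal_standard_normal_convert[OF \<sigma>, of L 0] by simp
    then have std: "distr \<mu> borel (\<lambda>f. L f / \<sigma>) = std_normal_distribution"
      using distr_cong[OF refl sets_lborel refl, of \<mu> "\<lambda>f. L f / \<sigma>"]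
      by (simp add: distributed_def)
    \<comment> \<open>Rescaling to the standard normal law turns the integral into the
      characteristic function of that law at \<open>\<sigma>\<close>.\<close>
    have "(\<integral>f. cos (L f) \<partial>\<mu>) = (\<integral>f. cos (\<sigma> * (L f / \<sigma>)) \<partial>\<mu>)"
      using \<sigma> by simp
    also have "\<dots> = (\<integral>s. cos (\<sigma> * s) \<partial>std_normal_distribution)"
      unfolding std[symmetric] by (subst integral_distr) auto
    also have "\<dots> = (\<integral>s. Re (iexp (\<sigma> * s)) \<partial>std_normal_distribution)"
      by (simp add: Re_exp)
    also have "\<dots> = Re (char std_normal_distribution \<sigma>)"
    proof -
      interpret N: prob_space std_normal_distribution
        by (rule prob_space_normal_density) simp
      show ?thesis
        unfolding char_def by (intro integral_Re N.integrable_const_bound[where B=1]) auto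
    qed
    also have "\<dots> = exp (- \<sigma>\<^sup>2 / 2)"
      unfolding char_std_normal_distribution by simp
    finally show ?thesis
      using int var by simp
  qed
  then show "integrable \<mu> (\<lambda>f. (L f)\<^sup>2)"
    and "(\<integral>f. cos (L f) \<partial>\<mu>) = exp (- (\<integral>f. (L f)\<^sup>2 \<partial>\<mu>) / 2)"
    by auto
qed

lemma zero_mean_gaussian_borel_measurable:
  fixes \<mu> :: "'f::banach measure" and h :: "'f \<Rightarrow> 'b::topological_space"
  assumes "zero_mean_gaussian \<mu>" "continuous_on UNIV h"
  shows "h \<in> borel_measurable \<mu>"
  using assms borel_measurable_continuous_onI[of h]
  by (simp add: zero_mean_gaussian_def cong: measurable_cong_sets)

text \<open>By dominated convergence \<open>E cos(L\<^sub>i) \<longlonglongrightarrow> 1\<close>, and \<open>E cos(L\<^sub>i) = exp(- E L\<^sub>i\<^sup>2 / 2)\<close>; this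
  avoids an integrable majorant of \<open>L\<^sub>i\<^sup>2\<close> (Fernique's theorem).\<close>

lemma zero_mean_gaussian_variance_tendsto_0:
  fixes \<mu> :: "'f::banach measure" and L :: "nat \<Rightarrow> 'f \<Rightarrow> real"
  assumes \<mu>: "zero_mean_gaussian \<mu>" and L: "\<And>i. bounded_linear (L i)"
    and lim: "\<And>f. (\<lambda>i. L i f) \<longlonglongrightarrow> 0"
  shows "(\<lambda>i. \<integral>f. (L i f)\<^sup>2 \<partial>\<mu>) \<longlonglongrightarrow> 0"
proof -
  interpret prob_space \<mu>
    using \<mu> by (simp add: zero_mean_gaussian_def)
  have [measurable]: "L i \<in> borel_measurable \<mu>" for i
    by (rule zero_mean_gaussian_borel_measurable[OF \<mu> linear_continuous_on[OF L]])
  have "(\<lambda>i. \<integral>f. cos (L i f) \<partial>\<mu>) \<longlonglongrightarrow> (\<integral>f. 1 \<partial>\<mu>)"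
  proof (rule integral_dominated_convergence[where w="\<lambda>_. 1"])
    show "AE f in \<mu>. (\<lambda>i. cos (L i f)) \<longlonglongrightarrow> 1"
      using tendsto_cos[OF lim] by simp
  qed auto
  then have "(\<lambda>i. exp (- (\<integral>f. (L i f)\<^sup>2 \<partial>\<mu>) / 2)) \<longlonglongrightarrow> 1"
    using zero_mean_gaussian_functional(2)[OF \<mu> L] by (simp add: prob_space)
  \<comment> \<open>Logarithms recover the variances, as \<open>ln\<close> is continuous at
    1.\<close>
  from tendsto_mult_left[OF tendsto_ln[OF this], of "- 2"] show ?thesis
    by simp
qed

section \<open>Separability and joint measurability\<close>

lemma separable_space_dense_sequence:
  assumes "separable_space (euclidean :: 'f::metric_space topology)"
  obtains q :: "nat \<Rightarrow> 'f::metric_space" where "\<And>f e. 0 < e \<Longrightarrow> \<exists>k. dist f (q k) < e"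
proof -
  obtain C :: "'f set" where C: "countable C" "closure C = UNIV"
    using assms by (auto simp: separable_space_def)
  then have "C \<noteq> {}"
    by auto
  then have "range (from_nat_into C) = C"
    using C by (simp add: range_from_nat_into)
  then have "\<exists>k. dist f (from_nat_into C k) < e" if "0 < e" for f and e :: real
    using C(2) that closure_approachable[of f C] by (metis UNIV_I dist_commute rangeE)
  then show ?thesis
    by (rule that)
qed

text \<open>One point of \<open>S\<close> is picked from every basis set that meets
  \<open>S\<close>.\<close>

lemma second_countable_dense_subset:
  fixes S :: "'a::second_countable_topology set"
  obtains T where "countable T" "T \<subseteq> S" "S \<subseteq> closure T"
proof -
  obtain B :: "'a set set" where B: "countable B" "topological_basis B"
    using ex_countable_basis by blast
  have "\<exists>x. x \<in> b \<inter> S" if "b \<in> {b \<in> B. b \<inter> S \<noteq> {}}" for b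
    using that by blast
  then obtain p where p: "\<And>b. b \<in> {b \<in> B. b \<inter> S \<noteq> {}} \<Longrightarrow> p b \<in> b \<inter> S"
    by metis
  show ?thesis
  proof
    show "countable (p ` {b \<in> B. b \<inter> S \<noteq> {}})"
      using B(1) by simp
    show "p ` {b \<in> B. b \<inter> S \<noteq> {}} \<subseteq> S"
      using p by blast
    show "S \<subseteq> closure (p ` {b \<in> B. b \<inter> S \<noteq> {}})"
    proof
      fix x assume x: "x \<in> S"
      show "x \<in> closure (p ` {b \<in> B. b \<inter> S \<noteq> {}})"
        unfolding closure_iff_nhds_not_empty
      proof (intro allI impI)
        fix A V assume "V \<subseteq> A" "open V" "x \<in> V"
        then obtain b where b: "b \<in> B" "x \<in> b" "b \<subseteq> V"
          using B(2) by (meson topological_basisE)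
        then have "p b \<in> b \<inter> S"
          using p x by blast
        then show "p ` {b \<in> B. b \<inter> S \<noteq> {}} \<inter> A \<noteq> {}"
          using b x \<open>V \<subseteq> A\<close> by blast
      qed
    qed
  qed
qed

text \<open>On functionals of norm at most \<open>m\<close>, pointwise convergence is convergence at the points of a
  dense sequence, and \<open>nat \<Rightarrow> real\<close> is second countable.\<close>

lemma bounded_linear_countable_dense:
  fixes L :: "'a \<Rightarrow> 'f::real_normed_vector \<Rightarrow> real"
  assumes sep: "separable_space (euclidean :: 'f topology)"
    and L: "\<And>y. y \<in> D \<Longrightarrow> bounded_linear (L y)"
  obtains D0 where "countable D0" "D0 \<subseteq> D"
    "\<And>y. y \<in> D \<Longrightarrow> \<exists>s. (\<forall>i. s i \<in> D0) \<and> (\<forall>f. (\<lambda>i. L (s i) f) \<longlonglongrightarrow> L y f)"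
proof -
  obtain q :: "nat \<Rightarrow> 'f" where q: "\<And>f e. 0 < e \<Longrightarrow> \<exists>k. dist f (q k) < e"
    using separable_space_dense_sequence[OF sep] by blast
  \<comment> \<open>Each \<open>y\<close> in \<open>D\<close> lies in some \<open>D' m\<close>; the
    bound uniform on \<open>D' m\<close> extends convergence from the dense sequence to all
    \<open>f\<close>.\<close>
  define D' where "D' m = {y \<in> D. \<forall>f. \<bar>L y f\<bar> \<le> real m * norm f}" for m
  define \<Phi> where "\<Phi> y = (\<lambda>k. L y (q k))" for y
  have "\<exists>T. countable T \<and> T \<subseteq> D' m \<and> \<Phi> ` D' m \<subseteq> closure (\<Phi> ` T)" for m
  proof -
    obtain T where T: "countable T" "T \<subseteq> \<Phi> ` D' m" "\<Phi> ` D' m \<subseteq> closure T"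
      using second_countable_dense_subset by blast
    obtain T' where "countable T'" "T' \<subseteq> D' m" "T = \<Phi> ` T'"
      using T(1,2) countable_subset_image[of T \<Phi> "D' m"] by blast
    then show ?thesis
      using T by blast
  qed
  then obtain T where T: "\<And>m. countable (T m)" "\<And>m. T m \<subseteq> D' m" "\<And>m. \<Phi> ` D' m \<subseteq> closure (\<Phi> ` T m)"
    by metis
  show ?thesis
  proof
    show "countable (\<Union>m. T m)"
      using T by simp
    show "(\<Union>m. T m) \<subseteq> D"
      using T(2) by (auto simp: D'_def)
    fix y assume y: "y \<in> D"
    obtain B where B: "\<And>f. \<bar>L y f\<bar> \<le> norm f * B"
      using bounded_linear.bounded[OF L[OF y]] by auto
    obtain m where m: "B \<le> real m"
      using real_arch_simple by blast
    have "\<bar>L y f\<bar> \<le> real m * norm f" for f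
      using B[of f] mult_left_mono[OF m, of "norm f"] by (simp add: mult.commute)
    then have ym: "y \<in> D' m"
      using y by (simp add: D'_def)
    then have "\<Phi> y \<in> closure (\<Phi> ` T m)"
      using T(3) by blast
    then obtain z where z: "\<And>i. z i \<in> \<Phi> ` T m" "z \<longlonglongrightarrow> \<Phi> y"
      unfolding closure_sequential by blast
    then have "\<exists>t\<in>T m. z i = \<Phi> t" for i
      by blast
    then obtain s where s: "\<And>i. s i \<in> T m" "\<And>i. z i = \<Phi> (s i)"
      by metis
    have dense: "(\<lambda>i. L (s i) (q k)) \<longlonglongrightarrow> L y (q k)" for k
      using continuous_on_tendsto_compose[OF continuous_on_product_coordinates z(2), of k]
      by (simp add: s \<Phi>_def)
    have "(\<lambda>i. L (s i) f) \<longlonglongrightarrow> L y f" for f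
    proof (rule LIMSEQ_I)
      fix e :: real assume e: "0 < e"
      \<comment> \<open>Chosen so that \<open>real m * d\<close> stays below \<open>e / 3\<close>;
        adding 1 keeps the denominator positive for \<open>m = 0\<close>.\<close>
      define d where "d = e / (3 * (real m + 1))"
      have "0 < d"
        using e by (simp add: d_def)
      then obtain k where k: "dist f (q k) < d"
        using q by blast
      have near: "\<bar>L t f - L t (q k)\<bar> < e / 3" if "t \<in> D' m" for t
      proof -
        have "\<bar>L t f - L t (q k)\<bar> = \<bar>L t (f - q k)\<bar>"
          using L that by (simp add: D'_def linear_diff bounded_linear.linear)
        also have "\<dots> \<le> real m * norm (f - q k)"
          using that by (simp add: D'_def)
        also have "\<dots> \<le> real m * d"
          using k by (intro mult_left_mono) (auto simp: dist_norm)
        also have "\<dots> < e / 3"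
          using e by (simp add: d_def field_simps)
        finally show ?thesis .
      qed
      obtain N where N: "\<And>i. N \<le> i \<Longrightarrow> \<bar>L (s i) (q k) - L y (q k)\<bar> < e / 3"
        using LIMSEQ_D[OF dense, of "e / 3" k] e by auto
      have "\<bar>L (s i) f - L y f\<bar> < e" if "N \<le> i" for i
      proof -
        have "\<bar>L (s i) f - L (s i) (q k)\<bar> < e / 3"
          using near s(1) T(2) by blast
        then show ?thesis
          using near[OF ym] N[OF that] by linarith
      qed
      then show "\<exists>N. \<forall>i\<ge>N. norm (L (s i) f - L y f) < e"
        by auto
    qed
    then show "\<exists>s. (\<forall>i. s i \<in> (\<Union>m. T m)) \<and> (\<forall>f. (\<lambda>i. L (s i) f) \<longlonglongrightarrow> L y f)"
      using s by blast
  qed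
qed

text \<open>Replace \<open>f\<close> by the first point of a dense sequence that is \<open>1/n\<close>-close to it.\<close>

lemma Caratheodory_borel_measurable:
  fixes v :: "'f::metric_space \<Rightarrow> 'a \<Rightarrow> real"
  assumes sep: "separable_space (euclidean :: 'f topology)"
    and M: "sets M = sets borel"
    and cont: "\<And>t. t \<in> space N \<Longrightarrow> continuous_on UNIV (\<lambda>f. v f t)"
    and meas: "\<And>f. v f \<in> borel_measurable N"
  shows "(\<lambda>(f, t). v f t) \<in> borel_measurable (M \<Otimes>\<^sub>M N)"
proof -
  obtain q :: "nat \<Rightarrow> 'f" where q: "\<And>f e. 0 < e \<Longrightarrow> \<exists>k. dist f (q k) < e"
    using separable_space_dense_sequence[OF sep] by blast
  \<comment> \<open>Taking the least index makes \<open>\<kappa> i\<close> measurable, as it depends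
    on countably many measurable conditions on distances.\<close>
  define \<kappa> where "\<kappa> i f = (LEAST k. dist f (q k) < inverse (real (Suc i)))" for i f
  have \<kappa>: "dist f (q (\<kappa> i f)) < inverse (real (Suc i))" for i f
    unfolding \<kappa>_def by (rule LeastI_ex, rule q) simp
  have [measurable]: "(\<lambda>f. dist f (q k)) \<in> borel_measurable M" for k
    using borel_measurable_continuous_onI[of "\<lambda>f. dist f (q k)"] M
    by (simp add: continuous_intros cong: measurable_cong_sets)
  have [measurable]: "\<kappa> i \<in> M \<rightarrow>\<^sub>M count_space UNIV" for i
    unfolding \<kappa>_def by measurable
  note meas[measurable]
  \<comment> \<open>As \<open>\<kappa> i\<close> has countably many values, measurability of
    \<open>v (q k)\<close> for each fixed \<open>k\<close> suffices.\<close>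
  have "(\<lambda>p. v (q (\<kappa> i (fst p))) (snd p)) \<in> borel_measurable (M \<Otimes>\<^sub>M N)" for i
    by (rule measurable_compose_countable[where g="\<lambda>p. \<kappa> i (fst p)" and f="\<lambda>k p. v (q k) (snd p)"]) measurable
  moreover have "(\<lambda>i. v (q (\<kappa> i (fst p))) (snd p)) \<longlonglongrightarrow> (case p of (f, t) \<Rightarrow> v f t)"
    if mem: "p \<in> space (M \<Otimes>\<^sub>M N)" for p
  proof -
    obtain f t where p: "p = (f, t)" "t \<in> space N"
      using mem by (cases p) (auto simp: space_pair_measure)
    have "(\<lambda>i. q (\<kappa> i f)) \<longlonglongrightarrow> f"
    proof (rule metric_tendsto_imp_tendsto[OF LIMSEQ_inverse_real_of_nat])
      show "\<forall>\<^sub>F i in sequentially. dist (q (\<kappa> i f)) f \<le> dist (inverse (real (Suc i))) 0"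
        using less_imp_le[OF \<kappa>] by (intro always_eventually) (simp add: dist_commute)
    qed
    then show ?thesis
      using continuous_on_tendsto_compose[OF cont[OF p(2)]] by (simp add: p)
  qed
  ultimately show ?thesis
    by (rule borel_measurable_LIMSEQ_real[rotated])
qed

lemma ennsqrt_square: "(ennsqrt a)\<^sup>2 = a"
  by (cases a) (simp_all add: ennsqrt_def ennreal_power)

lemma ennsqrt_ennreal: "0 \<le> r \<Longrightarrow> ennsqrt (ennreal r) = ennreal (sqrt r)"
  by (simp add: ennsqrt_def)

lemma ennsqrt_mono: "a \<le> b \<Longrightarrow> ennsqrt a \<le> ennsqrt b"
  by (cases a; cases b) (auto simp: ennsqrt_def top_unique intro!: ennreal_leI)

section \<open>The covariance kernel\<close>

text \<open>\<open>kcomb (\<lambda>_. val f) c s\<close> is \<open>\<Sum>\<^sub>t c t * val f t\<close>, whatever \<open>s\<close> is.\<close>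

lemma bounded_linear_kcomb:
  assumes "\<forall>t\<in>D. bounded_linear (\<lambda>f. val f t)" "c \<in> kcoeffs D"
  shows "bounded_linear (\<lambda>f. kcomb (\<lambda>_. val f) c s)"
  unfolding kcomb_def using assms
  by (intro bounded_linear_sum bounded_linear_const_mult) (auto simp: kcoeffs_def)

text \<open>Polarisation reduces the product to squares of functionals.\<close>

lemma zero_mean_gaussian_integrable_mult:
  fixes \<mu> :: "'f::banach measure" and L M :: "'f \<Rightarrow> real"
  assumes \<mu>: "zero_mean_gaussian \<mu>" and L: "bounded_linear L" and M: "bounded_linear M"
  shows "integrable \<mu> (\<lambda>f. L f * M f)"
proof -
  have "integrable \<mu> (\<lambda>f. ((L f + M f)\<^sup>2 - (L f)\<^sup>2 - (M f)\<^sup>2) / 2)"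
    using zero_mean_gaussian_functional(1)[OF \<mu>] L M bounded_linear_add[OF L M] by simp
  then show ?thesis
    by (simp add: power2_sum)
qed

text \<open>The isometry into L2(\<open>\<mu>\<close>): both sides expand into one finite double sum
  with integrable terms. The point \<open>s\<close> is a dummy.\<close>

lemma kinner_cov_kernel:
  fixes \<mu> :: "'f::banach measure" and val :: "'f \<Rightarrow> 'a \<Rightarrow> real"
  assumes \<mu>: "zero_mean_gaussian \<mu>"
    and ev: "\<forall>t\<in>D. bounded_linear (\<lambda>f. val f t)"
    and c: "c \<in> kcoeffs D" and d: "d \<in> kcoeffs D"
  shows "kinner (cov_kernel val \<mu>) c d
    = (\<integral>f. kcomb (\<lambda>_. val f) c s * kcomb (\<lambda>_. val f) d s \<partial>\<mu>)"
proof -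
  have int: "integrable \<mu> (\<lambda>f. c t * d u * (val f t * val f u))" if "c t \<noteq> 0" "d u \<noteq> 0" for t u
    using that c d by (intro integrable_mult_right zero_mean_gaussian_integrable_mult[OF \<mu>] ev[rule_format])
      (auto simp: kcoeffs_def)
  have "kinner (cov_kernel val \<mu>) c d
      = (\<Sum>t | c t \<noteq> 0. \<Sum>u | d u \<noteq> 0. \<integral>f. c t * d u * (val f t * val f u) \<partial>\<mu>)"
    by (simp add: kinner_def cov_kernel_def)
  also have "\<dots> = (\<integral>f. (\<Sum>t | c t \<noteq> 0. \<Sum>u | d u \<noteq> 0. c t * d u * (val f t * val f u)) \<partial>\<mu>)"
    using int by (subst Bochner_Integration.integral_sum)
      (auto intro!: sum.cong simp: Bochner_Integration.integral_sum)
  also have "\<dots> = (\<integral>f. kcomb (\<lambda>_. val f) c s * kcomb (\<lambda>_. val f) d s \<partial>\<mu>)"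
    by (simp add: kcomb_def sum_product mult_ac)
  finally show ?thesis .
qed

lemma psd_kernel_cov_kernel:
  fixes \<mu> :: "'f::banach measure" and val :: "'f \<Rightarrow> 'a \<Rightarrow> real"
  assumes "zero_mean_gaussian \<mu>" "\<forall>t\<in>D. bounded_linear (\<lambda>f. val f t)"
  shows "psd_kernel D (cov_kernel val \<mu>)"
proof
  show "cov_kernel val \<mu> s t = cov_kernel val \<mu> t s" for s t
    by (simp add: cov_kernel_def mult.commute)
  show "0 \<le> kinner (cov_kernel val \<mu>) c c" if "c \<in> kcoeffs D" for c
    \<comment> \<open>With both families equal the integrand is a square; \<open>undefined\<close>
      fills the dummy point.\<close>
    by (simp add: kinner_cov_kernel[OF assms that that, of undefined])
qed

text \<open>This is \<open>kcomb_hcoeff\<close> for a kernel that ignores its first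
  argument.\<close>

lemma kcomb_val_hcoeff:
  "kcomb (\<lambda>_. val f) (hcoeff n x g y) s = val f y - sample_alg n x g (val f) y"
  by (simp add: kcomb_hcoeff hstar_def sample_alg_def mult.commute)

section \<open>The error formulas\<close>

locale gaussian_sampling =
  fixes D :: "(real ^ 'd) set"
    and val :: "'f::banach \<Rightarrow> real ^ 'd \<Rightarrow> real"
    and \<mu> :: "'f measure"
    and n :: nat
    and x :: "nat \<Rightarrow> real ^ 'd"
    and g :: "nat \<Rightarrow> real ^ 'd \<Rightarrow> real"
  assumes D: "D \<in> lmeasurable" "0 < measure lebesgue D"
    and F: "separable_function_space D val"
    and \<mu>: "zero_mean_gaussian \<mu>"
    and H: "rkhs D (cov_kernel val \<mu>) \<subseteq> Linf D"
    and x: "\<And>j. j \<in> {1..n} \<Longrightarrow> x j \<in> D"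
    and g: "\<And>j. j \<in> {1..n} \<Longrightarrow> g j \<in> Linf D"
begin

abbreviation "R \<equiv> cov_kernel val \<mu>"
abbreviation "U \<equiv> sample_alg n x g"
abbreviation "h y \<equiv> hcoeff n x g y"
abbreviation "err y f \<equiv> val f y - U (val f) y"

section \<open>Error functionals and their representers\<close>

lemma evaluation_bounded_linear: "\<forall>t\<in>D. bounded_linear (\<lambda>f. val f t)"
  using F by (simp add: separable_function_space_def)

sublocale psd_kernel D R
  by (rule psd_kernel_cov_kernel[OF \<mu> evaluation_bounded_linear])

sublocale prob_space \<mu>
  using \<mu> by (simp add: zero_mean_gaussian_def)

sublocale lebD: finite_measure "lebesgue_on D"
  using D(1) by (rule finite_measure_lebesgue_on)

lemma space_lebD [simp]: "space (lebesgue_on D) = D"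
  by (simp add: space_restrict_space)

lemma h_in_kcoeffs: "y \<in> D \<Longrightarrow> h y \<in> kcoeffs D"
  by (intro hcoeff_in_kcoeffs x)

lemma rkhs_norm_hstar: "y \<in> D \<Longrightarrow> rkhs_norm D R (hstar R n x g y) = knorm R (h y)"
  by (simp add: kcomb_hcoeff[symmetric] rkhs_norm_kcomb h_in_kcoeffs)

lemma err_bounded_linear: "y \<in> D \<Longrightarrow> bounded_linear (err y)"
  using bounded_linear_kcomb[OF evaluation_bounded_linear h_in_kcoeffs[of y]]
  by (simp add: kcomb_val_hcoeff)

lemma knorm_h_square: "y \<in> D \<Longrightarrow> (knorm R (h y))\<^sup>2 = (\<integral>f. (err y f)\<^sup>2 \<partial>\<mu>)"
  using kinner_cov_kernel[OF \<mu> evaluation_bounded_linear h_in_kcoeffs[of y] h_in_kcoeffs[of y]]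
  by (simp add: knorm_square h_in_kcoeffs kcomb_val_hcoeff flip: power2_eq_square)

text \<open>Turns L2(\<open>\<mu>\<close>) convergence of error functionals into norm convergence of
  their representers.\<close>

lemma knorm_h_diff_square:
  assumes "y \<in> D" "z \<in> D"
  shows "(knorm R (\<lambda>t. h y t - h z t))\<^sup>2 = (\<integral>f. (err y f - err z f)\<^sup>2 \<partial>\<mu>)"
proof -
  have c: "(\<lambda>t. h y t - h z t) \<in> kcoeffs D"
    using assms by (intro kcoeffs_diff h_in_kcoeffs)
  have "kcomb (\<lambda>_. val f) (\<lambda>t. h y t - h z t) s = err y f - err z f" for f s
    by (simp only: kcomb_diff[OF assms[THEN h_in_kcoeffs]] kcomb_val_hcoeff)
  then show ?thesis
    using kinner_cov_kernel[OF \<mu> evaluation_bounded_linear c c]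
    by (simp add: knorm_square[OF c] flip: power2_eq_square)
qed

lemma sample_alg_measurable [measurable]: "(\<lambda>t. U f t) \<in> borel_measurable (lebesgue_on D)"
  unfolding sample_alg_def using g by (intro borel_measurable_sum borel_measurable_times) (auto simp: Linf_def)

text \<open>The error is continuous in \<open>f\<close> for each \<open>t\<close> in
  \<open>D\<close> and measurable in \<open>t\<close> for each \<open>f\<close>; Tonelli needs it
  jointly measurable.\<close>

lemma err_measurable [measurable]: "(\<lambda>(f, t). err t f) \<in> borel_measurable (\<mu> \<Otimes>\<^sub>M lebesgue_on D)"
proof (rule Caratheodory_borel_measurable)
  show "separable_space (euclidean :: 'f topology)"
    using F by (simp add: separable_function_space_def)
  show "sets \<mu> = sets borel"
    using \<mu> by (simp add: zero_mean_gaussian_def)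
  show "continuous_on UNIV (err t)" if "t \<in> space (lebesgue_on D)" for t
    using that by (intro linear_continuous_on err_bounded_linear) simp
  show "(\<lambda>t. err t f) \<in> borel_measurable (lebesgue_on D)" for f
    using F by (intro borel_measurable_diff sample_alg_measurable)
      (simp add: separable_function_space_def L2_def)
qed

lemma knorm_h_measurable [measurable]:
  "(\<lambda>y. knorm R (h y)) \<in> borel_measurable (lebesgue_on D)"
proof -
  have [measurable]: "(\<lambda>(t, f). (err t f)\<^sup>2) \<in> borel_measurable (lebesgue_on D \<Otimes>\<^sub>M \<mu>)"
    using measurable_pair_swap[OF err_measurable] by (simp add: split_beta')
  have "(\<lambda>t. sqrt (\<integral>f. (err t f)\<^sup>2 \<partial>\<mu>)) \<in> borel_measurable (lebesgue_on D)"
    by measurable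
  then show ?thesis
    by (rule measurable_cong[THEN iffD1, rotated])
      (simp add: knorm_h_square[symmetric] knorm_nonneg h_in_kcoeffs)
qed

section \<open>The average case error\<close>

lemma avg_error_eq:
  "avg_error D val \<mu> U = ennsqrt (\<integral>\<^sup>+ y. ennreal ((knorm R (h y))\<^sup>2) \<partial>lebesgue_on D)"
proof -
  interpret pair_sigma_finite \<mu> "lebesgue_on D" ..
  have "(\<integral>\<^sup>+ f. (L2_norm D (\<lambda>t. err t f))\<^sup>2 \<partial>\<mu>)
      = (\<integral>\<^sup>+ f. \<integral>\<^sup>+ t. ennreal ((err t f)\<^sup>2) \<partial>lebesgue_on D \<partial>\<mu>)"
    by (simp add: L2_norm_def ennsqrt_square)
  also have "\<dots> = (\<integral>\<^sup>+ t. \<integral>\<^sup>+ f. ennreal ((err t f)\<^sup>2) \<partial>\<mu> \<partial>lebesgue_on D)"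
    using Fubini'[of "\<lambda>f t. ennreal ((err t f)\<^sup>2)"] err_measurable by (simp add: split_beta')
  \<comment> \<open>Second moments are finite, so the inner integral agrees with the Bochner
    integral in \<open>knorm_h_square\<close>.\<close>
  also have "\<dots> = (\<integral>\<^sup>+ t. ennreal ((knorm R (h t))\<^sup>2) \<partial>lebesgue_on D)"
    using zero_mean_gaussian_functional(1)[OF \<mu> err_bounded_linear]
    by (intro nn_integral_cong) (simp add: nn_integral_eq_integral knorm_h_square)
  finally show ?thesis
    by (simp add: avg_error_def)
qed

section \<open>The worst case error\<close>

lemma wor_error_le: "wor_error D R U \<le> esssup (lebesgue_on D) (\<lambda>y. ennreal (knorm R (h y)))"
  unfolding wor_error_def
proof (rule SUP_least)
  fix f assume "f \<in> {f \<in> rkhs D R. rkhs_norm D R f \<le> 1}"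
  then have f: "f \<in> rkhs D R" "rkhs_norm D R f \<le> 1"
    by auto
  have [measurable]: "f \<in> borel_measurable (lebesgue_on D)"
    using H f by (auto simp: Linf_def)
  have "\<bar>f y - U f y\<bar> \<le> knorm R (h y)" if y: "y \<in> D" for y
    using rkhs_error_le[of y n x f g] y x f(1) mult_right_mono[OF f(2) knorm_nonneg[OF h_in_kcoeffs[OF y]]]
    by simp
  then show "Linf_norm D (\<lambda>t. f t - U f t) \<le> esssup (lebesgue_on D) (\<lambda>y. ennreal (knorm R (h y)))"
    unfolding Linf_norm_def by (intro esssup_AE_mono AE_I2) (auto intro: ennreal_leI)
qed

text \<open>For a single \<open>y\<close> one would test with its own normalised representer, but
  each test function is controlled only off a null set of its own. So countably many
  \<open>z\<close> are tested first, and the representer of \<open>y\<close> is approximated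
  afterwards.\<close>

lemma AE_knorm_h_le: "AE y in lebesgue_on D. ennreal (knorm R (h y)) \<le> wor_error D R U"
proof (cases "wor_error D R U")
  case (real w)
  have sep: "separable_space (euclidean :: 'f topology)"
    using F by (simp add: separable_function_space_def)
  obtain D0 where D0: "countable D0" "D0 \<subseteq> D"
    and dense: "\<And>y. y \<in> D \<Longrightarrow> \<exists>s. (\<forall>i. s i \<in> D0) \<and> (\<forall>f. (\<lambda>i. err (s i) f) \<longlonglongrightarrow> err y f)"
    by (rule bounded_linear_countable_dense[where D=D and L="\<lambda>y. err y", OF sep err_bounded_linear])
      blast+
  have "AE y in lebesgue_on D. \<bar>kinner R (h z) (h y)\<bar> \<le> w * knorm R (h z)" if "z \<in> D0" for z
  proof (cases "knorm R (h z) = 0")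
    \<comment> \<open>A representer of norm 0 cannot be normalised; Cauchy-Schwarz settles this
      case.\<close>
    case True
    have "\<bar>kinner R (h z) (h y)\<bar> \<le> 0" if "y \<in> D" for y
      using kinner_Cauchy_Schwarz[OF h_in_kcoeffs[of z] h_in_kcoeffs[OF that]] D0 \<open>z \<in> D0\<close> True by auto
    then show ?thesis
      by (intro AE_I2) (simp add: True)
  next
    case False
    have z: "h z \<in> kcoeffs D"
      using D0 that by (auto intro: h_in_kcoeffs)
    then have pos: "0 < knorm R (h z)"
      using False knorm_nonneg[of "h z"] by simp
    \<comment> \<open>The error of this test function at \<open>y\<close> is the pairing of the
      representers of \<open>z\<close> and \<open>y\<close>, divided by the norm of the
      former.\<close>
    define c where "c = (\<lambda>t. inverse (knorm R (h z)) * h z t)"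
    have c: "c \<in> kcoeffs D"
      unfolding c_def using z by (rule kcoeffs_scale)
    have "rkhs_norm D R (kcomb R c) = 1"
      using pos by (simp add: rkhs_norm_kcomb[OF c]) (simp add: c_def knorm_scale[OF z])
    then have le: "Linf_norm D (\<lambda>t. kcomb R c t - U (kcomb R c) t) \<le> wor_error D R U"
      unfolding wor_error_def using kcomb_in_rkhs[OF c] by (intro SUP_upper) simp
    have "AE y in lebesgue_on D. ennreal \<bar>kcomb R c y - U (kcomb R c) y\<bar>
        \<le> Linf_norm D (\<lambda>t. kcomb R c t - U (kcomb R c) t)"
      unfolding Linf_norm_def by (rule esssup_AE)
    then have ae: "AE y in lebesgue_on D. ennreal \<bar>kcomb R c y - U (kcomb R c) y\<bar> \<le> wor_error D R U"
      by (rule AE_mp) (intro AE_I2 impI order_trans[OF _ le])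
    have bound: "\<bar>kinner R (h z) (h y)\<bar> \<le> w * knorm R (h z)"
      if y: "y \<in> D" and le: "ennreal \<bar>kcomb R c y - U (kcomb R c) y\<bar> \<le> wor_error D R U" for y
    proof -
      have "kcomb R c y - U (kcomb R c) y = kinner R c (h y)"
        using kinner_hcoeff[of y n x c g] y x c by simp
      also have "\<dots> = inverse (knorm R (h z)) * kinner R (h z) (h y)"
        unfolding c_def by (rule kinner_scale_left[OF z])
      finally have "inverse (knorm R (h z)) * \<bar>kinner R (h z) (h y)\<bar> \<le> w"
        using le real pos by (simp add: abs_mult)
      then show ?thesis
        using pos by (simp add: field_simps)
    qed
    show ?thesis
      using ae by (elim AE_mp, intro AE_I2 impI) (auto intro: bound)
  qed
  \<comment> \<open>The countably many exceptional null sets are merged into one.\<close>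
  then have ae: "AE y in lebesgue_on D. \<forall>z\<in>D0. \<bar>kinner R (h z) (h y)\<bar> \<le> w * knorm R (h z)"
    using D0(1) by (simp add: AE_ball_countable)
  have bound: "knorm R (h y) \<le> w"
    if y: "y \<in> D" and le: "\<forall>z\<in>D0. \<bar>kinner R (h z) (h y)\<bar> \<le> w * knorm R (h z)" for y
  proof -
    obtain s where s: "\<And>i. s i \<in> D0" "\<And>f. (\<lambda>i. err (s i) f) \<longlonglongrightarrow> err y f"
      using dense[OF y] by blast
    have sD: "s i \<in> D" for i
      using s D0 by blast
    note hs = h_in_kcoeffs[OF sD] and hy = h_in_kcoeffs[OF y]
    \<comment> \<open>Pointwise convergence of the functionals is upgraded to
      L2(\<open>\<mu>\<close>), hence to norm convergence of the representers.\<close>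
    have "(\<lambda>i. \<integral>f. (err (s i) f - err y f)\<^sup>2 \<partial>\<mu>) \<longlonglongrightarrow> 0"
    proof (rule zero_mean_gaussian_variance_tendsto_0[OF \<mu>])
      show "bounded_linear (\<lambda>f. err (s i) f - err y f)" for i
        by (intro bounded_linear_sub err_bounded_linear sD y)
      show "(\<lambda>i. err (s i) f - err y f) \<longlonglongrightarrow> 0" for f
        by (rule LIM_zero[OF s(2)])
    qed
    then have "(\<lambda>i. (knorm R (\<lambda>t. h (s i) t - h y t))\<^sup>2) \<longlonglongrightarrow> 0"
      by (simp add: knorm_h_diff_square[OF sD y])
    then have lim: "(\<lambda>i. knorm R (\<lambda>t. h (s i) t - h y t)) \<longlonglongrightarrow> 0"
      by simp
    have "(\<lambda>i. knorm R (h (s i)) - knorm R (h y)) \<longlonglongrightarrow> 0"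
      by (rule Lim_null_comparison[OF _ lim]) (use knorm_diff_ineq[OF hs hy] in simp)
    then have lim_norm: "(\<lambda>i. knorm R (h (s i))) \<longlonglongrightarrow> knorm R (h y)"
      by (rule LIM_zero_cancel)
    have "(\<lambda>i. kinner R (h (s i)) (h y) - kinner R (h y) (h y)) \<longlonglongrightarrow> 0"
    proof (rule Lim_null_comparison)
      show "(\<lambda>i. knorm R (\<lambda>t. h (s i) t - h y t) * knorm R (h y)) \<longlonglongrightarrow> 0"
        using lim by (rule tendsto_mult_left_zero)
      show "\<forall>\<^sub>F i in sequentially. norm (kinner R (h (s i)) (h y) - kinner R (h y) (h y))
          \<le> knorm R (\<lambda>t. h (s i) t - h y t) * knorm R (h y)"
        using kinner_Cauchy_Schwarz[OF kcoeffs_diff[OF hs hy] hy] kinner_diff_left[OF hs hy] by simp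
    qed
    then have "(\<lambda>i. kinner R (h (s i)) (h y)) \<longlonglongrightarrow> (knorm R (h y))\<^sup>2"
      unfolding knorm_square[OF hy] by (rule LIM_zero_cancel)
    moreover have "kinner R (h (s i)) (h y) \<le> w * knorm R (h (s i))" for i
      using le s(1)[of i] by (meson abs_le_D1)
    \<comment> \<open>Limit of the tested inequalities. Dividing by the norm gives the bound; for
      norm 0 it holds since \<open>w\<close> is nonnegative.\<close>
    ultimately have "(knorm R (h y))\<^sup>2 \<le> w * knorm R (h y)"
      using tendsto_mult_left[OF lim_norm, of w] by (intro LIMSEQ_le) auto
    then show ?thesis
      using real knorm_nonneg[OF hy] by (cases "knorm R (h y) = 0") (auto simp: power2_eq_square)
  qed
  show ?thesis
    using ae unfolding real by (elim AE_mp, intro AE_I2 impI ennreal_leI) (auto intro: bound)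
qed simp

text \<open>The essential supremum is the least almost everywhere upper bound.\<close>

lemma wor_error_eq: "wor_error D R U = esssup (lebesgue_on D) (\<lambda>y. ennreal (knorm R (h y)))"
  using wor_error_le AE_knorm_h_le by (intro antisym esssup_I) auto

section \<open>Comparison of the two errors\<close>

lemma avg_error_le: "avg_error D val \<mu> U \<le> ennreal (sqrt (measure lebesgue D)) * wor_error D R U"
proof (cases "wor_error D R U")
  case (real w)
  have "ennreal ((knorm R (h y))\<^sup>2) \<le> ennreal (w\<^sup>2)"
    if "y \<in> D" "ennreal (knorm R (h y)) \<le> wor_error D R U" for y
    using that real knorm_nonneg[OF h_in_kcoeffs[OF that(1)]] by (intro ennreal_leI power_mono) auto
  then have "(\<integral>\<^sup>+ y. ennreal ((knorm R (h y))\<^sup>2) \<partial>lebesgue_on D) \<le> (\<integral>\<^sup>+ y. ennreal (w\<^sup>2) \<partial>lebesgue_on D)"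
    using AE_knorm_h_le by (intro nn_integral_mono_AE, elim AE_mp) (auto intro!: AE_I2)
  also have "\<dots> = ennreal (w\<^sup>2 * measure lebesgue D)"
    using D(1) by (simp add: emeasure_restrict_space emeasure_eq_measure2 fmeasurableD ennreal_mult)
  finally have "avg_error D val \<mu> U \<le> ennsqrt (ennreal (w\<^sup>2 * measure lebesgue D))"
    unfolding avg_error_eq by (rule ennsqrt_mono)
  also have "\<dots> = ennreal (sqrt (measure lebesgue D)) * wor_error D R U"
    using real by (subst ennsqrt_ennreal) (simp_all add: real_sqrt_mult ennreal_mult mult.commute)
  finally show ?thesis .
next
  \<comment> \<open>Positive volume makes the right side infinite; in \<open>ennreal\<close> a
    factor 0 would give 0.\<close>
  case top
  then show ?thesis
    using D(2) by (simp add: ennreal_mult_top)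
qed

end

theorem mainTheorem4:
  fixes D :: "(real ^ 'd) set"
    and val :: "'f::banach \<Rightarrow> real ^ 'd \<Rightarrow> real"
    and \<mu> :: "'f measure"
    and R :: "real ^ 'd \<Rightarrow> real ^ 'd \<Rightarrow> real"
    and n :: nat
    and x :: "nat \<Rightarrow> real ^ 'd"
    and g :: "nat \<Rightarrow> real ^ 'd \<Rightarrow> real"
    and U :: "(real ^ 'd \<Rightarrow> real) \<Rightarrow> real ^ 'd \<Rightarrow> real"
  assumes D: "D \<in> lmeasurable" "0 < measure lebesgue D"
    and F: "separable_function_space D val"
    and \<mu>: "zero_mean_gaussian \<mu>"
    and R: "R = cov_kernel val \<mu>"
    and H: "rkhs D R \<subseteq> Linf D"
    and x: "\<And>j. j \<in> {1..n} \<Longrightarrow> x j \<in> D"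
    and g: "\<And>j. j \<in> {1..n} \<Longrightarrow> g j \<in> Linf D"
    and U: "U = sample_alg n x g"
  shows "(\<forall>y\<in>D. hstar R n x g y \<in> rkhs D R) \<and>
         avg_error D val \<mu> U =
           ennsqrt (\<integral>\<^sup>+ y. ennreal ((rkhs_norm D R (hstar R n x g y))\<^sup>2) \<partial>lebesgue_on D) \<and>
         wor_error D R U =
           esssup (lebesgue_on D) (\<lambda>y. ennreal (rkhs_norm D R (hstar R n x g y))) \<and>
         avg_error D val \<mu> U \<le> ennreal (sqrt (measure lebesgue D)) * wor_error D R U"
proof -
  interpret gaussian_sampling D val \<mu> n x g
    using D F \<mu> H x g unfolding R by unfold_locales
  have norm: "rkhs_norm D (cov_kernel val \<mu>) (hstar (cov_kernel val \<mu>) n x g y)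
      = knorm (cov_kernel val \<mu>) (hcoeff n x g y)" if "y \<in> space (lebesgue_on D)" for y
    using that by (simp add: rkhs_norm_hstar)
  \<comment> \<open>Measurability of the definite description \<open>rkhs_norm\<close> is carried
    over from \<open>knorm\<close>, with which it agrees on \<open>D\<close>.\<close>
  have meas: "(\<lambda>y. ennreal (rkhs_norm D (cov_kernel val \<mu>) (hstar (cov_kernel val \<mu>) n x g y)))
      \<in> borel_measurable (lebesgue_on D)"
    using norm by (subst measurable_cong[of "lebesgue_on D"]) auto
  have "wor_error D R U = esssup (lebesgue_on D) (\<lambda>y. ennreal (rkhs_norm D R (hstar R n x g y)))"
    unfolding R U wor_error_eq
    by (rule esssup_AE_cong) (use meas norm in \<open>auto intro!: AE_I2\<close>)
  moreover have "avg_error D val \<mu> U =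
      ennsqrt (\<integral>\<^sup>+ y. ennreal ((rkhs_norm D R (hstar R n x g y))\<^sup>2) \<partial>lebesgue_on D)"
    unfolding R U avg_error_eq
    by (intro arg_cong[of _ _ ennsqrt] nn_integral_cong) (simp add: norm)
  moreover have "\<forall>y\<in>D. hstar R n x g y \<in> rkhs D R"
    unfolding R using kcomb_in_rkhs[OF h_in_kcoeffs] by (simp add: kcomb_hcoeff)
  ultimately show ?thesis
    using avg_error_le unfolding R U by blast
qed

end
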